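(* (i) Let $n\ge0$ and $k$ be integers with $n\le k\le 3n$, and let $\eta=k-n$. If $\eta\le n$ then $$E_2(n,k)=\frac{(n+\eta)!}{\eta!\,(n-\eta)!\,2^\eta}\;{}_2F_1\!\left[-\tfrac{\eta}{2},-\tfrac{\eta}{2}+\tfrac12;\,n-\eta+1;\,\tfrac83\right].$$ If $\eta\ge n$ then $$E_2(n,k)=\frac{(\eta+n)!}{(2n-\eta)!\,(\eta-n)!\,2^n\,3^{\eta-n}}\;{}_2F_1\!\left[-n+\tfrac{\eta}{2},-n+\tfrac{\eta}{2}+\tfrac12;\,\eta-n+1;\,\tfrac83\right].$$ (ii) For all $n\ge0$, $$G_2(n)=\sum_{\eta=0}^{n-1}\frac{(n+\eta)!}{\eta!\,(n-\eta)!\,2^\eta}\,{}_2F_1\!\left[-\tfrac{\eta}{2},-\tfrac{\eta}{2}+\tfrac12;\,n-\eta+1;\,\tfrac83\right]+\sum_{\eta=n}^{2n}\frac{(n+\eta)!}{(2n-\eta)!\,(\eta-n)!\,2^n\,3^{\eta-n}}\,{}_2F_1\!\left[-n+\tfrac{\eta}{2},-n+\tfrac{\eta}{2}+\tfrac12;\,\eta-n+1;\,\tfrac83\right].$$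
   Context: $E_2(n,k)$ is the number of partitions of $\{1,\ldots,k\}$ into exactly $n$ nonempty blocks, each of size at most $3$. ${}_2F_1[a,b;c;z]=\sum_{j\ge0}\frac{(a)_j(b)_j}{(c)_j\,j!}z^j$ with $(a)_j=a(a+1)\cdots(a+j-1)$; in all instances above one numerator parameter is a nonpositive integer and $c$ is a positive integer, so the series is a finite sum. Gift exchange game with steal limit $\sigma\ge 0$ and $m\ge 1$ gifts: there are $m$ players and $m$ distinct wrapped gifts, initially all in a pool. The players are called one at a time in a fixed order. When a player is called, and also whenever a player's gift has just been stolen, that player (who currently holds no gift) makes a move: either take one of the gifts still in the pool (it is unwrapped and held by that player), or steal an unwrapped gift currently held by another player, provided this gift has so far been stolen fewer than $\sigma$ times in total; the player from whom it was stolen then immediately makes a move. The game ends as soon as the last gift in the pool is taken. A scenario is the complete sequence of moves. For $n\ge 0$, $G_2(n)$ is the number of scenarios of the game with steal limit $\sigma=2$ and $m=n+1$ gifts in which the gifts are taken from the pool in the order $1,2,\ldots,n+1$. *)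

theory Defs
  imports Complex_Main "HOL-Library.Disjoint_Sets"
begin

definition E2 :: "nat \<Rightarrow> nat \<Rightarrow> nat" where
  "E2 n k = card {P. partition_on {1..k} P \<and> card P = n \<and> (\<forall>B\<in>P. card B \<le> 3)}"

definition hyp2F1 :: "real \<Rightarrow> real \<Rightarrow> real \<Rightarrow> real \<Rightarrow> real" where
  "hyp2F1 a b c z =
     (\<Sum>j. pochhammer a j * pochhammer b j / (pochhammer c j * fact j) * z ^ j)"

text \<open>
  The gift exchange game. Gifts and players are numbered from 1, players being called in
  increasing order. A move does not record who makes it, since the preceding moves determine this.
\<close>

datatype move = Take nat | Steal nat

record game_state =
  mover :: nat
  called :: nat  \<comment> \<open>number of players called so far\<close>
  pool :: "nat set"
  holder :: "nat \<Rightarrow> nat option"  \<comment> \<open>the player holding a given gift\<close>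
  steals :: "nat \<Rightarrow> nat"  \<comment> \<open>how often a given gift has been stolen\<close>

definition initial_state :: "nat \<Rightarrow> game_state" where
  "initial_state m =
     \<lparr>mover = 1, called = 1, pool = {1..m}, holder = (\<lambda>_. None), steals = (\<lambda>_. 0)\<rparr>"

fun legal :: "nat \<Rightarrow> game_state \<Rightarrow> move \<Rightarrow> bool" where
  "legal \<sigma> s (Take g) \<longleftrightarrow> g \<in> pool s"
| "legal \<sigma> s (Steal g) \<longleftrightarrow> (\<exists>q. holder s g = Some q \<and> q \<noteq> mover s) \<and> steals s g < \<sigma>"

text \<open>
  Each player called takes part in a chain of moves that ends with exactly one gift leaving the
  pool. So with as many players as gifts there is a next player to call after every \<open>Take\<close>
  except the last one; the mover stored after the last one is irrelevant as the game is over.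
\<close>

fun make_move :: "game_state \<Rightarrow> move \<Rightarrow> game_state" where
  "make_move s (Take g) =
     s\<lparr>mover := called s + 1, called := called s + 1, pool := pool s - {g},
       holder := (holder s)(g := Some (mover s))\<rparr>"
| "make_move s (Steal g) =
     s\<lparr>mover := the (holder s g), holder := (holder s)(g := Some (mover s)),
       steals := (steals s)(g := steals s g + 1)\<rparr>"

fun complete_play :: "nat \<Rightarrow> game_state \<Rightarrow> move list \<Rightarrow> bool" where
  "complete_play \<sigma> s [] \<longleftrightarrow> pool s = {}"
| "complete_play \<sigma> s (a # as) \<longleftrightarrow>
     pool s \<noteq> {} \<and> legal \<sigma> s a \<and> complete_play \<sigma> (make_move s a) as"

definition scenarios :: "nat \<Rightarrow> nat \<Rightarrow> move list set" where
  "scenarios \<sigma> m = {as. complete_play \<sigma> (initial_state m) as}"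

fun taken :: "move list \<Rightarrow> nat list" where
  "taken [] = []"
| "taken (Take g # as) = g # taken as"
| "taken (Steal g # as) = taken as"

definition G2 :: "nat \<Rightarrow> nat" where
  "G2 n = card {as \<in> scenarios 2 (n + 1). taken as = [1..<n + 2]}"

end

theory Submission
  imports Defs "HOL-Computational_Algebra.Polynomial"
begin

text \<open>
  Let \<open>p = x + x\<^sup>2/2 + x\<^sup>3/6\<close>, so that \<open>p' = 1 + x + x\<^sup>2/2\<close> and \<open>p'' = 1 + x\<close>.
  Removing the block of the last element of a partition turns into differentiating \<open>p^n\<close>, hence
  \<open>E2 n k\<close> is \<open>k!/n!\<close> times the coefficient of \<open>x^k\<close> in \<open>p^n\<close>. Expanding
  \<open>p = x ((1 + x/2) + x\<^sup>2/6)\<close> by the binomial theorem gives a finite sum, indexed by the number of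
  blocks of size 3, which is the first hypergeometric sum; shifting the index to the number
  of singleton blocks gives the second one.

  For the game, consider a state with \<open>a\<close> gifts stolen never, \<open>b\<close> gifts stolen once and
  \<open>r + 1\<close> gifts in the pool. The number of its completions is the integral of
  \<open>exp (- x) p'^a p''^b p^r / r!\<close> over \<open>x \<ge> 0\<close>: integrating by parts, the product rule
  reproduces the choice of the next move. The initial state yields \<open>\<Sum>\<^sub>k E2 n k\<close>.
\<close>

section \<open>Partitions into blocks of size at most 3\<close>

definition block_poly :: "real poly" where
  "block_poly = [:0, 1, 1/2, 1/6:]"

text \<open>The ground set is arbitrary because removing a block from a partition of
  \<open>{1..k}\<close> need not leave an initial segment.\<close>

definition small_partitions :: "nat \<Rightarrow> 'a set \<Rightarrow> 'a set set set" where
  "small_partitions n A = {P. partition_on A P \<and> card P = n \<and> (\<forall>B\<in>P. card B \<le> 3)}"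

lemma finite_small_partitions: "finite A \<Longrightarrow> finite (small_partitions n A)"
  unfolding small_partitions_def
  by (rule finite_subset[OF _ finitely_many_partition_on[of A]]) auto

text \<open>Blocks in \<open>P\<close> and \<open>Q\<close> lie inside \<open>A\<close> and avoid
  \<open>x\<close>, so the block of \<open>x\<close> can be recognised on either side. The first
  conclusion yields disjointness, the second injectivity in the count below.\<close>

lemma insert_block_eq_iff:
  assumes "\<Union>P \<subseteq> A" "\<Union>Q \<subseteq> A" "x \<notin> A"
    and eq: "insert (insert x S) P = insert (insert x T) Q" and "x \<notin> S" "x \<notin> T"
  shows "S = T" "P = Q"
proof -
  have *: "insert x S \<notin> P" "insert x S \<notin> Q" "insert x T \<notin> P" "insert x T \<notin> Q"
    using assms(1-3) by auto
  with eq have "insert x S = insert x T"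
    by blast
  with assms(5,6) show "S = T"
    by (auto simp: insert_ident)
  with eq * show "P = Q"
    by (simp add: insert_ident)
qed

text \<open>\<open>S\<close> holds the companions of \<open>x\<close> in its block, which turns the
  size bound 3 into 2.\<close>

lemma small_partitions_insert:
  assumes A: "finite A" "x \<notin> A"
  shows "small_partitions (Suc n) (insert x A) =
           (\<Union>S\<in>{S. S \<subseteq> A \<and> card S \<le> 2}. insert (insert x S) ` small_partitions n (A - S))"
proof (intro equalityI subsetI)
  fix P assume P: "P \<in> small_partitions (Suc n) (insert x A)"
  then have part: "partition_on (insert x A) P" and small: "\<And>B. B \<in> P \<Longrightarrow> card B \<le> 3"
    and cardP: "card P = Suc n"
    by (auto simp: small_partitions_def)
  from part obtain B where B: "B \<in> P" "x \<in> B"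
    using partition_onD1 by fastforce
  define S where "S = B - {x}"
  have "B \<subseteq> insert x A"
    using part B partition_onD1 by fastforce
  then have S: "S \<subseteq> A" "x \<notin> S" "B = insert x S"
    using B by (auto simp: S_def)
  moreover have "finite S"
    using S A finite_subset by blast
  ultimately have "card S \<le> 2"
    using small[OF B(1)] by simp
  have "disjnt B (\<Union>(P - {B}))"
    using partition_onD2[OF part] B by (auto simp: disjoint_def disjnt_iff)
  then have "partition_on (insert x A - B) (P - {B})"
    using part B partition_on_insert[of B "P - {B}" "insert x A"] by (simp add: insert_absorb)
  moreover have "insert x A - B = A - S"
    using A S by auto
  moreover have "card (P - {B}) = n"
    using cardP B by simp
  ultimately have "P - {B} \<in> small_partitions n (A - S)"
    using small by (simp add: small_partitions_def)
  moreover have "P = insert (insert x S) (P - {B})"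
    using B S by auto
  ultimately show "P \<in> (\<Union>S\<in>{S. S \<subseteq> A \<and> card S \<le> 2}.
      insert (insert x S) ` small_partitions n (A - S))"
    using S \<open>card S \<le> 2\<close> by blast
next
  fix P assume "P \<in> (\<Union>S\<in>{S. S \<subseteq> A \<and> card S \<le> 2}.
      insert (insert x S) ` small_partitions n (A - S))"
  then obtain S Q where S: "S \<subseteq> A" "card S \<le> 2" and P: "P = insert (insert x S) Q"
    and Q: "partition_on (A - S) Q" "card Q = n" "\<And>B. B \<in> Q \<Longrightarrow> card B \<le> 3"
    by (auto simp: small_partitions_def)
  have U: "\<Union>Q = A - S"
    using Q(1) partition_onD1 by blast
  have fin: "finite Q" "finite S"
    using A Q(1) S finite_elements finite_subset by blast+
  have "insert x A - insert x S = A - S"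
    using A by auto
  then have "partition_on (insert x A) P"
    unfolding P using A S Q(1) U by (subst partition_on_insert) (auto simp: disjnt_iff)
  moreover have "insert x S \<notin> Q"
    using U A by auto
  then have "card P = Suc n"
    using fin Q(2) P by simp
  moreover have "card (insert x S) \<le> 3"
    using fin S by (simp add: card_insert_if)
  ultimately show "P \<in> small_partitions (Suc n) (insert x A)"
    using P Q(3) by (auto simp: small_partitions_def)
qed

lemma card_small_partitions_insert:
  assumes A: "finite A" "x \<notin> A"
  shows "card (small_partitions (Suc n) (insert x A)) =
           (\<Sum>S\<in>{S. S \<subseteq> A \<and> card S \<le> 2}. card (small_partitions n (A - S)))"
proof -
  have U: "\<Union>P \<subseteq> A" if "P \<in> small_partitions n (A - S)" for P S
    using that partition_onD1 by (fastforce simp: small_partitions_def)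
  have "inj_on (insert (insert x S)) (small_partitions n (A - S))" if "S \<subseteq> A" for S
  proof (rule inj_onI)
    fix P Q assume PQ: "P \<in> small_partitions n (A - S)" "Q \<in> small_partitions n (A - S)"
      and eq: "insert (insert x S) P = insert (insert x S) Q"
    show "P = Q"
      by (rule insert_block_eq_iff(2)[OF U[OF PQ(1)] U[OF PQ(2)] A(2) eq]) (use A that in auto)
  qed
  moreover have "insert (insert x S) ` small_partitions n (A - S) \<inter>
      insert (insert x T) ` small_partitions n (A - T) = {}"
    if "S \<subseteq> A" "T \<subseteq> A" "S \<noteq> T" for S T
  proof (rule ccontr)
    assume "\<not> ?thesis"
    then obtain P Q where PQ: "P \<in> small_partitions n (A - S)" "Q \<in> small_partitions n (A - T)"
      and eq: "insert (insert x S) P = insert (insert x T) Q"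
      by blast
    have "S = T"
      by (rule insert_block_eq_iff(1)[OF U[OF PQ(1)] U[OF PQ(2)] A(2) eq]) (use A that in auto)
    with that show False
      by simp
  qed
  ultimately show ?thesis
    unfolding small_partitions_insert[OF A] using A
    by (subst card_UN_disjoint) (auto simp: card_image finite_small_partitions)
qed

section \<open>The coefficient recursion for powers of \<open>block_poly\<close>\<close>

lemma pderiv_block_poly: "pderiv block_poly = [:1, 1, 1/2:]"
  by (simp add: block_poly_def pderiv_pCons)

lemma coeff_pderiv_block_poly: "coeff (pderiv block_poly) i = (if i \<le> 2 then 1 / fact i else 0)"
proof -
  consider "i = 0" | "i = 1" | "i = 2" | k where "i = Suc (Suc (Suc k))"
    by (metis One_nat_def Suc_1 old.nat.exhaust)
  then show ?thesis
    by cases (auto simp: pderiv_block_poly numeral_2_eq_2)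
qed

text \<open>Comparison of coefficients in (p^(n+1))' = (n+1) p' p^n.\<close>

lemma coeff_block_poly_power_Suc:
  "real (Suc k) * coeff (block_poly ^ Suc n) (Suc k) =
     real (Suc n) * (\<Sum>i\<in>{..k} \<inter> {..2}. coeff (block_poly ^ n) (k - i) / fact i)"
proof -
  have "real (Suc k) * coeff (block_poly ^ Suc n) (Suc k) =
      coeff (pderiv (block_poly ^ Suc n)) k"
    by (simp add: coeff_pderiv)
  also have "\<dots> = real (Suc n) * coeff (pderiv block_poly * block_poly ^ n) k"
    unfolding pderiv_power_Suc by (simp add: mult.commute)
  also have "coeff (pderiv block_poly * block_poly ^ n) k =
      (\<Sum>i\<le>k. if i \<in> {..2} then coeff (block_poly ^ n) (k - i) / fact i else 0)"
    unfolding coeff_mult by (intro sum.cong) (auto simp: coeff_pderiv_block_poly)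
  also have "\<dots> = (\<Sum>i\<in>{..k} \<inter> {..2}. coeff (block_poly ^ n) (k - i) / fact i)"
    by (subst sum.inter_restrict) auto
  finally show ?thesis .
qed

lemma sum_small_subsets:
  fixes f :: "nat \<Rightarrow> real"
  assumes "finite A"
  shows "(\<Sum>S\<in>{S. S \<subseteq> A \<and> card S \<le> m}. f (card (A - S))) =
           (\<Sum>i\<in>{..card A} \<inter> {..m}. real (card A choose i) * f (card A - i))"
proof -
  have fin: "finite {S. S \<subseteq> A \<and> card S \<le> m}"
    using assms by (rule rev_finite_subset[OF finite_Pow_iff[THEN iffD2]]) auto
  have "(\<Sum>S\<in>{S. S \<subseteq> A \<and> card S \<le> m}. f (card (A - S))) =
      (\<Sum>S\<in>{S. S \<subseteq> A \<and> card S \<le> m}. f (card A - card S))"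
    using assms by (intro sum.cong) (auto simp: card_Diff_subset finite_subset)
  also have "\<dots> = (\<Sum>i\<in>{..card A} \<inter> {..m}.
      \<Sum>S\<in>{S\<in>{S. S \<subseteq> A \<and> card S \<le> m}. card S = i}. f (card A - card S))"
    using fin assms by (intro sum.group[symmetric]) (auto intro: card_mono)
  also have "\<dots> = (\<Sum>i\<in>{..card A} \<inter> {..m}.
      \<Sum>S\<in>{S. S \<subseteq> A \<and> card S = i}. f (card A - i))"
    by (intro sum.cong) auto
  also have "\<dots> = (\<Sum>i\<in>{..card A} \<inter> {..m}. real (card A choose i) * f (card A - i))"
    using assms by (simp add: n_subsets)
  finally show ?thesis .
qed

text \<open>Both sides obey the same recursion: with \<open>k = card B\<close>, choosing
  \<open>i\<close> companions gives (k choose i) (k-i)! = k!/i!, and 1/i! is the coefficient of x^i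
  in p'.\<close>

lemma card_small_partitions:
  assumes "finite A"
  shows "real (card (small_partitions n A)) =
           fact (card A) * coeff (block_poly ^ n) (card A) / fact n"
  using assms
proof (induction n arbitrary: A)
  case 0
  have "small_partitions 0 A = (if A = {} then {{}} else {})"
    using 0 finite_elements[OF 0] by (auto simp: small_partitions_def partition_on_empty)
      (auto simp: partition_on_def)
  with 0 show ?case
    by auto
next
  case (Suc n)
  show ?case
  proof (cases "A = {}")
    case True
    then have "small_partitions (Suc n) A = {}"
      by (auto simp: small_partitions_def partition_on_empty)
    \<comment> \<open>\<open>block_poly\<close> has no constant term, so the right side vanishes
      too.\<close>
    with True show ?thesis
      by (simp add: coeff_mult block_poly_def)
  next
    case False
    then obtain x B where B: "A = insert x B" "x \<notin> B"
      by (meson Set.set_insert all_not_in_conv)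
    let ?k = "card B" and ?c = "\<lambda>k. coeff (block_poly ^ n) k"
    have fin: "finite B"
      using Suc.prems B by simp
    have "real (card (small_partitions (Suc n) A)) =
        (\<Sum>S\<in>{S. S \<subseteq> B \<and> card S \<le> 2}. fact (card (B - S)) * ?c (card (B - S)) / fact n)"
      unfolding B(1) card_small_partitions_insert[OF fin B(2)] using Suc.IH fin by simp
    also have "\<dots> = (\<Sum>i\<in>{..?k} \<inter> {..2}.
        real (?k choose i) * (fact (?k - i) * ?c (?k - i) / fact n))"
      by (rule sum_small_subsets[OF fin])
    also have "\<dots> = (\<Sum>i\<in>{..?k} \<inter> {..2}. fact ?k / fact n * (?c (?k - i) / fact i))"
      by (intro sum.cong) (auto simp: binomial_fact)
    also have "\<dots> = fact ?k / fact n * (\<Sum>i\<in>{..?k} \<inter> {..2}. ?c (?k - i) / fact i)"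
      by (simp add: sum_distrib_left)
    also have "\<dots> = fact ?k / fact n *
        (real (Suc ?k) * coeff (block_poly ^ Suc n) (Suc ?k) / real (Suc n))"
      unfolding coeff_block_poly_power_Suc by simp
    also have "\<dots> = fact (card A) * coeff (block_poly ^ Suc n) (card A) / fact (Suc n)"
      using B fin by (simp add: field_simps del: power_Suc)
    finally show ?thesis .
  qed
qed

lemma E2_eq_coeff: "real (E2 n k) = fact k * coeff (block_poly ^ n) k / fact n"
  using card_small_partitions[of "{1..k}" n] by (simp add: E2_def small_partitions_def)

section \<open>Terminating hypergeometric sums\<close>

lemma block_poly_eq: "block_poly = monom 1 1 * ([:1, 1/2:] + monom (1/6) 2)"
  by (simp add: block_poly_def monom_altdef numeral_2_eq_2)

lemma coeff_linear_poly_power':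
  "coeff ([:1, c:] ^ n) i = real (n choose i) * c ^ i"
proof (cases "i \<le> n")
  case True
  then show ?thesis by (simp add: coeff_linear_poly_power)
next
  case False
  have "degree ([:1, c:] ^ n) \<le> 1 * n"
    by (rule order_trans[OF degree_power_le]) simp
  with False show ?thesis
    by (simp add: coeff_eq_0)
qed

text \<open>After one x per block is split off, \<open>j\<close> factors contribute x^2/6 (blocks of
  size 3), \<open>e - 2 * j\<close> of the others x/2 (blocks of size 2), the rest 1.\<close>

lemma coeff_block_poly_power:
  "coeff (block_poly ^ n) (n + e) =
     (\<Sum>j | j \<le> n \<and> 2 * j \<le> e.
        real (n choose j) * real (n - j choose (e - 2 * j)) / (6 ^ j * 2 ^ (e - 2 * j)))"
proof -
  have "block_poly ^ n = monom 1 n * ([:1, 1/2:] + monom (1/6) 2) ^ n"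
    unfolding block_poly_eq power_mult_distrib monom_power by simp
  \<comment> \<open>The summands are swapped so that the index of \<open>binomial_ring\<close> is
    the exponent of the x^2/6 term.\<close>
  then have "coeff (block_poly ^ n) (n + e) = coeff ((monom (1/6) 2 + [:1, 1/2:]) ^ n) e"
    by (simp add: coeff_monom_mult add.commute)
  also have "\<dots> = (\<Sum>j\<le>n. if 2 * j \<le> e then
      real (n choose j) * real (n - j choose (e - 2 * j)) / (6 ^ j * 2 ^ (e - 2 * j)) else 0)"
    unfolding binomial_ring coeff_sum
    by (intro sum.cong refl)
      (auto simp: monom_power mult.assoc of_nat_poly coeff_monom_mult coeff_linear_poly_power' power_divide)
  also have "\<dots> = (\<Sum>j | j \<le> n \<and> 2 * j \<le> e.
      real (n choose j) * real (n - j choose (e - 2 * j)) / (6 ^ j * 2 ^ (e - 2 * j)))"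
    by (simp flip: sum.inter_filter)
  finally show ?thesis .
qed

text \<open>The numerator parameters differ by 1/2, so the duplication formula merges their
  Pochhammer symbols into \<open>pochhammer (- real N) (2 * j) / 4 ^ j\<close>, which vanishes for
  \<open>2 * j > N\<close>, whatever the parity of \<open>N\<close>.\<close>

lemma hyp2F1_terminating:
  "hyp2F1 (- (real N / 2)) (- (real N / 2) + 1 / 2) (real d + 1) z =
     (\<Sum>j | 2 * j \<le> N. fact N * fact d / (fact (N - 2 * j) * fact (d + j) * fact j) * (z / 4) ^ j)"
proof -
  have num: "pochhammer (- (real N / 2)) j * pochhammer (- (real N / 2) + 1 / 2) j =
      (if 2 * j \<le> N then fact N / (fact (N - 2 * j) * 4 ^ j) else 0)" for j
  proof -
    have "4 ^ j * (pochhammer (- (real N / 2)) j * pochhammer (- (real N / 2) + 1 / 2) j) =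
        pochhammer (- real N) (2 * j)"
      using pochhammer_double[of "- (real N / 2)" j] by (simp add: power_mult)
    also have "\<dots> = real (N choose (2 * j)) * fact (2 * j)"
      by (simp add: binomial_gbinomial gbinomial_pochhammer)
    also have "\<dots> = (if 2 * j \<le> N then fact N / fact (N - 2 * j) else 0)"
      by (auto simp: binomial_fact)
    finally show ?thesis
      by (auto simp: field_simps)
  qed
  have den: "pochhammer (real d + 1) j = fact (d + j) / fact d" for j
    using pochhammer_product'[of "1::real" d j]
    by (simp add: add.commute flip: pochhammer_fact)
  have "finite {j. 2 * j \<le> N}"
    by (rule finite_subset[of _ "{..N}"]) auto
  then show ?thesis
    unfolding hyp2F1_def num den
    by (subst suminf_finite[of "{j. 2 * j \<le> N}"]) (auto simp: power_divide intro!: sum.cong)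
qed

section \<open>The two hypergeometric forms of \<open>E2\<close>\<close>

lemma E2_hyp2F1_low:
  assumes "e \<le> n"
  shows "real (E2 n (n + e)) =
           fact (n + e) / (fact e * fact (n - e) * 2 ^ e) *
           hyp2F1 (- (real e / 2)) (- (real e / 2) + 1 / 2) (real n - real e + 1) (8 / 3)"
proof -
  have "real n - real e + 1 = real (n - e) + 1"
    using assms by simp
  moreover have "fact (n + e) * coeff (block_poly ^ n) (n + e) / fact n =
      fact (n + e) / (fact e * fact (n - e) * 2 ^ e) *
      (\<Sum>j | 2 * j \<le> e. fact e * fact (n - e) /
        (fact (e - 2 * j) * fact (n - e + j) * fact j) * (8 / 3 / 4) ^ j)"
    unfolding coeff_block_poly_power sum_distrib_left sum_divide_distrib
  proof (intro sum.cong)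
    show "{j. j \<le> n \<and> 2 * j \<le> e} = {j. 2 * j \<le> e}"
      using assms by auto
    fix j assume "j \<in> {j. 2 * j \<le> e}"
    then have j: "2 * j \<le> e" by simp
    then have [simp]: "n - j - (e - 2 * j) = n - e + j"
      using assms by simp
    have "real (n choose j) * real (n - j choose (e - 2 * j)) =
        fact n / (fact j * fact (e - 2 * j) * fact (n - e + j))"
      using j assms by (simp add: binomial_fact)
    moreover have "(2::real) ^ e = 2 ^ (e - 2 * j) * 4 ^ j"
      using j power_add[of "2::real" "e - 2 * j" "2 * j"] by (simp add: power_mult)
    \<comment> \<open>Raising \<open>j\<close> by one trades two blocks of size 2 (weight 1/4) for
      one of size 3 (weight 1/6) and a singleton: the ratio 4/6 is the origin of the argument
      8/3.\<close>
    moreover have "(8 / 3 / 4 :: real) ^ j = 4 ^ j / 6 ^ j"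
      by (simp flip: power_divide)
    ultimately show "fact (n + e) * (real (n choose j) * real (n - j choose (e - 2 * j)) /
          (6 ^ j * 2 ^ (e - 2 * j))) / fact n =
        fact (n + e) / (fact e * fact (n - e) * 2 ^ e) * (fact e * fact (n - e) /
          (fact (e - 2 * j) * fact (n - e + j) * fact j) * (8 / 3 / 4) ^ j)"
      by simp
  qed
  ultimately show ?thesis
    by (simp only: E2_eq_coeff hyp2F1_terminating)
qed

text \<open>The excess \<open>e\<close> forces at least \<open>d = e - n\<close> blocks of size 3.
  With \<open>j = d + i\<close> the index \<open>i\<close> counts singletons, and the sum has the
  earlier shape with \<open>N = 2 * n - e\<close> for \<open>e\<close> and \<open>d\<close> for
  \<open>n - e\<close>.\<close>

lemma E2_hyp2F1_high:
  assumes "n \<le> e" "e \<le> 2 * n"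
  shows "real (E2 n (n + e)) =
           fact (n + e) / (fact (2 * n - e) * fact (e - n) * 2 ^ n * 3 ^ (e - n)) *
           hyp2F1 (- real n + real e / 2) (- real n + real e / 2 + 1 / 2)
             (real e - real n + 1) (8 / 3)"
proof -
  define N d where "N = 2 * n - e" and "d = e - n"
  have n: "n = N + d" and e: "e = N + 2 * d"
    using assms by (auto simp: N_def d_def)
  have par: "- real n + real e / 2 = - (real N / 2)" "real e - real n + 1 = real d + 1"
    by (auto simp: n e field_simps)
  have "fact (n + e) * coeff (block_poly ^ n) (n + e) / fact n =
      (\<Sum>j | j \<le> n \<and> 2 * j \<le> e. fact (n + e) * (real (n choose j) *
        real (n - j choose (e - 2 * j)) / (6 ^ j * 2 ^ (e - 2 * j))) / fact n)"
    by (simp only: coeff_block_poly_power sum_distrib_left sum_divide_distrib)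
  also have "\<dots> = (\<Sum>j\<in>(+) d ` {i. 2 * i \<le> N}. fact (n + e) * (real (n choose j) *
        real (n - j choose (e - 2 * j)) / (6 ^ j * 2 ^ (e - 2 * j))) / fact n)"
  proof (rule sum.mono_neutral_right)
    show "finite {j. j \<le> n \<and> 2 * j \<le> e}"
      by (rule finite_subset[of _ "{..n}"]) auto
    show "(+) d ` {i. 2 * i \<le> N} \<subseteq> {j. j \<le> n \<and> 2 * j \<le> e}"
      by (auto simp: n e)
    show "\<forall>j\<in>{j. j \<le> n \<and> 2 * j \<le> e} - (+) d ` {i. 2 * i \<le> N}.
        fact (n + e) * (real (n choose j) * real (n - j choose (e - 2 * j)) /
          (6 ^ j * 2 ^ (e - 2 * j))) / fact n = 0"
    proof
      fix j assume j: "j \<in> {j. j \<le> n \<and> 2 * j \<le> e} - (+) d ` {i. 2 * i \<le> N}"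
      then have "j \<notin> (+) d ` {i. 2 * i \<le> N}" "2 * j \<le> e" by auto
      have "j < d"
      proof (rule ccontr)
        assume "\<not> j < d"
        with \<open>2 * j \<le> e\<close> have "j = d + (j - d)" "2 * (j - d) \<le> N"
          by (simp_all add: e)
        with \<open>j \<notin> (+) d ` {i. 2 * i \<le> N}\<close> show False
          by blast
      qed
      \<comment> \<open>With fewer than \<open>d\<close> triples, more pairs are required than
        blocks are left, so the binomial coefficient is 0.\<close>
      then have "n - j < e - 2 * j"
        by (simp add: n e)
      then show "fact (n + e) * (real (n choose j) * real (n - j choose (e - 2 * j)) /
          (6 ^ j * 2 ^ (e - 2 * j))) / fact n = 0"
        by simp
    qed
  qed
  also have "\<dots> = (\<Sum>i | 2 * i \<le> N. fact (n + e) * (real (n choose (d + i)) *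
        real (n - (d + i) choose (e - 2 * (d + i))) / (6 ^ (d + i) * 2 ^ (e - 2 * (d + i)))) / fact n)"
    by (subst sum.reindex) auto
  also have "\<dots> = fact (n + e) / (fact N * fact d * 2 ^ n * 3 ^ d) *
      (\<Sum>j | 2 * j \<le> N. fact N * fact d /
        (fact (N - 2 * j) * fact (d + j) * fact j) * (8 / 3 / 4) ^ j)"
    unfolding sum_distrib_left
  proof (intro sum.cong refl)
    fix j assume "j \<in> {j. 2 * j \<le> N}"
    then have j: "2 * j \<le> N" by simp
    have diffs: "n - (d + j) = N - j" "e - 2 * (d + j) = N - 2 * j" "N - j - (N - 2 * j) = j"
      using j by (auto simp: n e)
    have "real (n choose (d + j)) * real (N - j choose (N - 2 * j)) =
        fact n / (fact (d + j) * fact (N - 2 * j) * fact j)"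
      using j by (simp add: binomial_fact diffs n)
    moreover have "(2::real) ^ n * 3 ^ d = 2 ^ (N - 2 * j) * 4 ^ j * 6 ^ d"
    proof -
      \<comment> \<open>The last \<open>d\<close> factors 2 join \<open>3 ^ d\<close> to form
        \<open>6 ^ d\<close>, the part of \<open>6 ^ (d + j)\<close> independent of
        \<open>j\<close>.\<close>
      have "(2::real) ^ n = 2 ^ (N - 2 * j + 2 * j + d)"
        using j by (simp add: n)
      then show ?thesis
        unfolding power_add power_mult by (simp flip: power_mult_distrib)
    qed
    moreover have "(8 / 3 / 4 :: real) ^ j = 4 ^ j / 6 ^ j"
      by (simp flip: power_divide)
    ultimately show "fact (n + e) * (real (n choose (d + j)) *
        real (n - (d + j) choose (e - 2 * (d + j))) / (6 ^ (d + j) * 2 ^ (e - 2 * (d + j)))) / fact n =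
      fact (n + e) / (fact N * fact d * 2 ^ n * 3 ^ d) * (fact N * fact d /
        (fact (N - 2 * j) * fact (d + j) * fact j) * (8 / 3 / 4) ^ j)"
      unfolding diffs by (simp add: power_add mult.assoc)
  qed
  finally show ?thesis
    by (simp only: E2_eq_coeff par hyp2F1_terminating N_def[symmetric] d_def[symmetric])
qed

section \<open>Counting plays\<close>

text \<open>The value of \<open>laplace q\<close> is \<open>\<integral>\<^sub>0\<^sup>\<infinity> exp (- x) q(x) dx\<close>.\<close>

definition laplace :: "real poly \<Rightarrow> real" where
  "laplace q = (\<Sum>k\<le>degree q. fact k * coeff q k)"

lemma laplace_eq_sum:
  assumes "degree q \<le> N"
  shows "laplace q = (\<Sum>k\<le>N. fact k * coeff q k)"
  unfolding laplace_def using assms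
  by (intro sum.mono_neutral_left) (auto simp: coeff_eq_0)

lemma laplace_add: "laplace (p + q) = laplace p + laplace q"
proof -
  let ?N = "max (degree p) (degree q)"
  have "laplace (p + q) = (\<Sum>k\<le>?N. fact k * coeff (p + q) k)"
    by (intro laplace_eq_sum degree_add_le) auto
  also have "\<dots> = laplace p + laplace q"
    by (simp add: laplace_eq_sum[of p ?N] laplace_eq_sum[of q ?N] distrib_left sum.distrib)
  finally show ?thesis .
qed

lemma laplace_smult: "laplace (smult c q) = c * laplace q"
  using laplace_eq_sum[OF degree_smult_le, of c q]
  by (simp add: laplace_def sum_distrib_left mult.left_commute)

text \<open>Integration by parts.\<close>

lemma laplace_pderiv: "laplace q = poly q 0 + laplace (pderiv q)"
proof -
  \<comment> \<open>The extra top term is 0; it makes the sum run to \<open>degree q\<close> once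
    \<open>k = 0\<close> is split off.\<close>
  have "laplace q = (\<Sum>k\<le>Suc (degree q). fact k * coeff q k)"
    by (rule laplace_eq_sum) simp
  also have "\<dots> = coeff q 0 + (\<Sum>k\<le>degree q. fact k * coeff (pderiv q) k)"
    unfolding sum.atMost_Suc_shift by (simp add: coeff_pderiv algebra_simps)
  also have "\<dots> = poly q 0 + laplace (pderiv q)"
    by (simp add: laplace_eq_sum[of "pderiv q" "degree q"] degree_pderiv poly_0_coeff_0)
  finally show ?thesis .
qed

text \<open>\<open>[:1, 1:]\<close> is p''. A gift stolen twice would contribute p''' = 1, so only
  \<open>a\<close> and \<open>b\<close> are recorded.\<close>

definition play_poly :: "nat \<Rightarrow> nat \<Rightarrow> nat \<Rightarrow> real poly" where
  "play_poly a b r =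
     pderiv block_poly ^ a * [:1, 1:] ^ b * smult (1 / fact r) (block_poly ^ r)"

text \<open>The product rule lists the moves: p' to p'' steals a fresh gift, p'' to 1 a gift stolen
  once, and p^r/r! to p' p^(r-1)/(r-1)! takes from the pool. The truncated \<open>a - 1\<close> and
  \<open>b - 1\<close> at 0 are masked by the factor 0.\<close>

lemma pderiv_play_poly:
  "pderiv (play_poly a b r) =
     smult (real a) (play_poly (a - 1) (b + 1) r) + smult (real b) (play_poly a (b - 1) r) +
     (case r of 0 \<Rightarrow> 0 | Suc r' \<Rightarrow> play_poly (a + 1) b r')"
proof -
  define l :: "real poly" where "l = [:1, 1:]"
  define R where "R r = smult (1 / fact r) (block_poly ^ r)" for r
  have Q: "pderiv (pderiv block_poly ^ a) = smult (real a) (pderiv block_poly ^ (a - 1) * l)"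
    by (simp add: pderiv_power pderiv_block_poly pderiv_pCons l_def)
  have B: "pderiv (l ^ b) = smult (real b) (l ^ (b - 1))"
    by (simp add: pderiv_power l_def pderiv_pCons flip: one_pCons)
  have R: "pderiv (R r) = (case r of 0 \<Rightarrow> 0 | Suc r' \<Rightarrow> pderiv block_poly * R r')"
    by (cases r)
      (simp_all add: R_def pderiv_smult pderiv_power_Suc mult.commute del: power_Suc of_nat_Suc)
  show ?thesis
    unfolding play_poly_def l_def[symmetric] R_def[symmetric]
    by (simp add: pderiv_mult Q B R algebra_simps split: nat.split)
qed

lemma poly_play_poly_0: "poly (play_poly a b r) 0 = (if r = 0 then 1 else 0)"
  by (simp add: play_poly_def pderiv_block_poly poly_power) (simp add: block_poly_def)

text \<open>The boundary term survives only for \<open>r = 0\<close>, as p(0) = 0 and p'(0) = p''(0)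
  = 1; it counts taking the last gift.\<close>

lemma laplace_play_poly:
  "laplace (play_poly a b r) =
     (case r of 0 \<Rightarrow> 1 | Suc r' \<Rightarrow> laplace (play_poly (a + 1) b r')) +
     real a * laplace (play_poly (a - 1) (b + 1) r) + real b * laplace (play_poly a (b - 1) r)"
  by (subst laplace_pderiv)
    (simp add: pderiv_play_poly laplace_add laplace_smult poly_play_poly_0 split: nat.split,
      simp add: laplace_def)

text \<open>The invariant of play: nobody holds two gifts and the mover holds none, so a victim is
  empty-handed; the bound by \<open>called\<close> makes the next player called new; a gift from the
  pool enters \<open>held s 0\<close>.\<close>

definition valid_state :: "game_state \<Rightarrow> bool" where
  "valid_state s \<longleftrightarrow>
     finite (dom (holder s)) \<and> inj_on (holder s) (dom (holder s)) \<and>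
     (\<forall>q\<in>insert (mover s) (ran (holder s)). q \<le> called s) \<and> mover s \<notin> ran (holder s) \<and>
     (\<forall>g\<in>pool s. holder s g = None \<and> steals s g = 0)"

definition held :: "game_state \<Rightarrow> nat \<Rightarrow> nat set" where
  "held s i = {g \<in> dom (holder s). steals s g = i}"

definition plays :: "game_state \<Rightarrow> nat list \<Rightarrow> move list set" where
  "plays s gs = {as. complete_play 2 s as \<and> taken as = gs}"

lemma finite_held: "valid_state s \<Longrightarrow> finite (held s i)"
  by (auto simp: valid_state_def held_def)

lemma valid_initial_state: "valid_state (initial_state m)"
  by (simp add: valid_state_def initial_state_def)

lemma valid_state_Take:
  assumes "valid_state s" "g \<in> pool s"
  shows "valid_state (make_move s (Take g))"
proof -
  have g: "holder s g = None"
    using assms by (simp add: valid_state_def)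
  have "inj_on ((holder s)(g \<mapsto> mover s)) (insert g (dom (holder s)))"
    using assms(1) g by (auto simp: valid_state_def inj_on_def ran_def)
  moreover have "called s + 1 \<notin> insert (mover s) (ran (holder s))"
    using assms(1) by (force simp: valid_state_def)
  moreover have "\<forall>q\<in>insert (mover s) (ran (holder s)). q \<le> called s + 1"
    using assms(1) by (auto simp: valid_state_def intro: le_SucI)
  ultimately show ?thesis
    using assms g by (auto simp: valid_state_def ran_map_upd)
qed

text \<open>The thief replaces the victim in the range of \<open>holder\<close>, and the victim
  becomes the mover.\<close>

lemma valid_state_Steal:
  assumes "valid_state s" "g \<in> dom (holder s)"
  shows "valid_state (make_move s (Steal g))"
proof -
  obtain q where q: "holder s g = Some q"
    using assms(2) by blast
  have fin: "finite (dom (holder s))" and inj: "inj_on (holder s) (dom (holder s))"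
    and mover: "mover s \<notin> ran (holder s)"
    using assms(1) by (simp_all add: valid_state_def)
  have dom: "insert g (dom (holder s)) = dom (holder s)"
    using assms(2) by blast
  have "inj_on ((holder s)(g \<mapsto> mover s)) (dom (holder s))"
    using inj mover by (intro inj_on_fun_updI) (auto simp: ran_def)
  moreover have "ran ((holder s)(g \<mapsto> mover s)) = ran (holder s) - {q} \<union> {mover s}"
    using q inj mover by (rule ran_map_upd_Some)
  moreover have "q \<in> ran (holder s)"
    using q by (rule ranI)
  ultimately show ?thesis
    using assms(1) fin mover q by (auto simp: valid_state_def dom)
qed

text \<open>The mover is outside the range of \<open>holder\<close>, so every held gift belongs to
  another player; the counts below 2 are 0 and 1.\<close>

lemma legal_Steal_iff:
  assumes "valid_state s"
  shows "legal 2 s (Steal g) \<longleftrightarrow> g \<in> held s 0 \<union> held s 1"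
  using assms by (auto simp: valid_state_def held_def ran_def)

lemma held_Take:
  assumes "valid_state s" "g \<in> pool s"
  shows "held (make_move s (Take g)) 0 = insert g (held s 0)"
    and "held (make_move s (Take g)) 1 = held s 1"
    and "g \<notin> held s 0"
  using assms by (auto simp: valid_state_def held_def)

lemma held_Steal:
  assumes "g \<in> held s i"
  shows "held (make_move s (Steal g)) j =
    (if j = i then held s i - {g} else if j = Suc i then insert g (held s j) else held s j)"
  using assms by (auto simp: held_def)

section \<open>Recursion over the first move\<close>

lemma plays_Nil:
  assumes "pool s = {}"
  shows "plays s [] = {[]}"
proof (rule set_eqI)
  fix as
  show "as \<in> plays s [] \<longleftrightarrow> as \<in> {[]}"
    using assms by (cases as) (simp_all add: plays_def)
qed

text \<open>A first \<open>Take\<close> must remove \<open>g\<close>, the next gift in the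
  prescribed order; a theft leaves all of \<open>g # gs\<close> to be taken.\<close>

lemma plays_Cons:
  assumes "valid_state s" "g \<in> pool s"
  shows "plays s (g # gs) =
    (#) (Take g) ` plays (make_move s (Take g)) gs \<union>
    (\<Union>h\<in>held s 0 \<union> held s 1. (#) (Steal h) ` plays (make_move s (Steal h)) (g # gs))"
    (is "?L = ?R")
proof (intro set_eqI iffI)
  fix as assume as: "as \<in> ?L"
  then obtain m as' where "as = m # as'"
    by (cases as) (auto simp: plays_def)
  with as legal_Steal_iff[OF assms(1)] show "as \<in> ?R"
    by (cases m) (auto simp: plays_def simp del: legal.simps(2) make_move.simps)
next
  fix as assume "as \<in> ?R"
  then show "as \<in> ?L"
    using assms legal_Steal_iff[OF assms(1)]
    by (auto simp: plays_def simp del: legal.simps(2) make_move.simps)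
qed

text \<open>The count satisfies the recursion \<open>laplace_play_poly\<close>. Finiteness is
  carried along so that cardinalities of disjoint unions add up.\<close>

lemma finite_card_plays:
  assumes "valid_state s" "pool s = set (g # gs)" "distinct (g # gs)"
    and "card (held s 0) = a" "card (held s 1) = b"
  shows "finite (plays s (g # gs)) \<and>
         real (card (plays s (g # gs))) = laplace (play_poly a b (length gs))"
  using assms
\<comment> \<open>Every move lowers this measure by 1: taking a gift changes it by -3 + 2, stealing
  a fresh one by -2 + 1, stealing one stolen once by -1.\<close>
proof (induction "3 * length gs + 2 * a + b" arbitrary: s g gs a b rule: less_induct)
  case less
  have g: "g \<in> pool s"
    using less.prems by simp
  note fin = finite_held[OF less.prems(1)]
  let ?T = "plays (make_move s (Take g)) gs"
  let ?S = "\<lambda>h. plays (make_move s (Steal h)) (g # gs)"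
  have T: "finite ?T \<and> real (card ?T) =
      (case length gs of 0 \<Rightarrow> 1 | Suc r \<Rightarrow> laplace (play_poly (a + 1) b r))"
  proof (cases gs)
    case Nil
    then show ?thesis
      using less.prems by (simp add: plays_Nil)
  next
    case (Cons g' gs')
    have "finite (plays (make_move s (Take g)) (g' # gs')) \<and>
        real (card (plays (make_move s (Take g)) (g' # gs'))) =
        laplace (play_poly (a + 1) b (length gs'))"
    proof (rule less.hyps)
      show "valid_state (make_move s (Take g))"
        using less.prems(1) g by (rule valid_state_Take)
      show "card (held (make_move s (Take g)) 0) = a + 1"
        "card (held (make_move s (Take g)) 1) = b"
        using held_Take[OF less.prems(1) g] fin less.prems by simp_all
    qed (use less.prems Cons in auto)
    then show ?thesis
      by (simp add: Cons)
  qed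
  have S: "finite (?S h) \<and> real (card (?S h)) =
      (if h \<in> held s 0 then laplace (play_poly (a - 1) (b + 1) (length gs))
       else laplace (play_poly a (b - 1) (length gs)))"
    if h: "h \<in> held s 0 \<union> held s 1" for h
  proof -
    have valid: "valid_state (make_move s (Steal h))"
      using less.prems(1) h by (intro valid_state_Steal) (auto simp: held_def)
    have pool: "pool (make_move s (Steal h)) = set (g # gs)"
      using less.prems by simp
    show ?thesis
    proof (cases "h \<in> held s 0")
      case True
      then have "h \<notin> held s 1"
        by (simp add: held_def)
      have "a > 0"
        using fin[of 0] less.prems(4) True by (auto simp: card_gt_0_iff)
      have cards: "card (held (make_move s (Steal h)) 0) = a - 1"
        "card (held (make_move s (Steal h)) 1) = b + 1"
        using held_Steal[OF True] True \<open>h \<notin> held s 1\<close> fin less.prems(4,5) by simp_all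
      have "finite (?S h) \<and>
          real (card (?S h)) = laplace (play_poly (a - 1) (b + 1) (length gs))"
        by (rule less.hyps[OF _ valid pool less.prems(3) cards]) (use \<open>a > 0\<close> in simp)
      with True show ?thesis
        by simp
    next
      case False
      with h have h1: "h \<in> held s 1"
        by simp
      then have "b > 0"
        using fin[of 1] less.prems(5) by (auto simp: card_gt_0_iff)
      have cards: "card (held (make_move s (Steal h)) 0) = a"
        "card (held (make_move s (Steal h)) 1) = b - 1"
        using held_Steal[OF h1] h1 fin less.prems(4,5) by simp_all
      have "finite (?S h) \<and>
          real (card (?S h)) = laplace (play_poly a (b - 1) (length gs))"
        by (rule less.hyps[OF _ valid pool less.prems(3) cards]) (use \<open>b > 0\<close> in simp)
      with False show ?thesis
        by simp
    qed
  qed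
  let ?SS = "\<Union>h\<in>held s 0 \<union> held s 1. (#) (Steal h) ` ?S h"
  have disj: "held s 0 \<inter> held s 1 = {}"
    by (auto simp: held_def)
  have finSS: "finite ?SS"
    using S fin by blast
  have "card ?SS = (\<Sum>h\<in>held s 0 \<union> held s 1. card (?S h))"
    using S fin by (subst card_UN_disjoint) (auto simp: card_image simp del: make_move.simps)
  then have "real (card ?SS) = (\<Sum>h\<in>held s 0 \<union> held s 1. real (card (?S h)))"
    by simp
  also have "\<dots> = (\<Sum>h\<in>held s 0. real (card (?S h))) + (\<Sum>h\<in>held s 1. real (card (?S h)))"
    using fin disj by (intro sum.union_disjoint)
  also have "(\<Sum>h\<in>held s 0. real (card (?S h))) =
      real a * laplace (play_poly (a - 1) (b + 1) (length gs))"
    using S less.prems(4) by (simp del: make_move.simps)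
  also have "(\<Sum>h\<in>held s 1. real (card (?S h))) =
      (\<Sum>h\<in>held s 1. laplace (play_poly a (b - 1) (length gs)))"
    using S disj by (intro sum.cong) auto
  also have "\<dots> = real b * laplace (play_poly a (b - 1) (length gs))"
    using less.prems(5) by simp
  finally have cardSS: "real (card ?SS) =
      real a * laplace (play_poly (a - 1) (b + 1) (length gs)) +
      real b * laplace (play_poly a (b - 1) (length gs))" .
  have "card (plays s (g # gs)) = card ?T + card ?SS"
    unfolding plays_Cons[OF less.prems(1) g] using T finSS
    by (subst card_Un_disjoint) (auto simp: card_image simp del: make_move.simps)
  then have "real (card (plays s (g # gs))) = laplace (play_poly a b (length gs))"
    unfolding laplace_play_poly[of a b] using T cardSS by simp
  moreover have "finite (plays s (g # gs))"
    unfolding plays_Cons[OF less.prems(1) g] using T finSS by simp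
  ultimately show ?case
    by simp
qed

section \<open>From plays to sums of \<open>E2\<close>\<close>

lemma degree_block_poly_power: "degree (block_poly ^ n) \<le> 3 * n"
  using degree_power_le[of block_poly n] by (simp add: block_poly_def)

text \<open>Initially nothing is held and the pool has \<open>n + 1\<close> gifts, so the integrand
  is exp(-x) p^n/n!. Since x^k integrates to k!, the coefficient of x^k contributes
  \<open>E2 n k\<close>.\<close>

lemma G2_eq_sum_E2: "real (G2 n) = (\<Sum>k\<le>3 * n. real (E2 n k))"
proof -
  have "[1..<n + 2] = 1 # [2..<n + 2]"
    by (simp add: upt_conv_Cons numeral_2_eq_2)
  then have "real (G2 n) = real (card (plays (initial_state (n + 1)) (1 # [2..<n + 2])))"
    by (simp add: G2_def scenarios_def plays_def)
  also have "\<dots> = laplace (play_poly 0 0 n)"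
  proof -
    have "pool (initial_state (n + 1)) = set (1 # [2..<n + 2])"
      by (auto simp: initial_state_def)
    moreover have "held (initial_state (n + 1)) i = {}" for i
      by (simp add: held_def initial_state_def)
    ultimately show ?thesis
      using finite_card_plays[OF valid_initial_state, of "n + 1" 1 "[2..<n + 2]" 0 0]
      by (simp del: upt_Suc)
  qed
  also have "\<dots> = (1 / fact n) * (\<Sum>k\<le>3 * n. fact k * coeff (block_poly ^ n) k)"
    by (simp add: play_poly_def laplace_smult laplace_eq_sum[OF degree_block_poly_power])
  also have "\<dots> = (\<Sum>k\<le>3 * n. real (E2 n k))"
    by (simp add: E2_eq_coeff sum_distrib_left)
  finally show ?thesis .
qed

lemma E2_eq_0:
  assumes "k < n"
  shows "E2 n k = 0"
proof -
  from assms have "coeff (block_poly ^ n) k = 0"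
    unfolding block_poly_eq power_mult_distrib monom_power by (simp add: coeff_monom_mult)
  then show ?thesis
    using E2_eq_coeff[of n k] by simp
qed

text \<open>With \<open>k = n + e\<close> the range splits at \<open>e = n\<close>, where both
  closed forms apply; that term goes to the second sum.\<close>

lemma G2_eq_sum_E2_split:
  "real (G2 n) =
     (\<Sum>e = 0..<n. real (E2 n (n + e))) + (\<Sum>e = n..2 * n. real (E2 n (n + e)))"
proof -
  have "real (G2 n) = (\<Sum>k = 0 + n..2 * n + n. real (E2 n k))"
    unfolding G2_eq_sum_E2 by (intro sum.mono_neutral_right) (auto simp: E2_eq_0)
  also have "\<dots> = (\<Sum>e = 0..2 * n. real (E2 n (n + e)))"
    unfolding sum.shift_bounds_cl_nat_ivl by (simp add: add.commute)
  also have "{0..2 * n} = {0..<n} \<union> {n..2 * n}"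
    by auto
  also have "(\<Sum>e\<in>\<dots>. real (E2 n (n + e))) =
      (\<Sum>e = 0..<n. real (E2 n (n + e))) + (\<Sum>e = n..2 * n. real (E2 n (n + e)))"
    by (rule sum.union_disjoint) auto
  finally show ?thesis .
qed

theorem theorem5:
  "(\<forall>n k \<eta> :: nat. n \<le> k \<and> k \<le> 3 * n \<and> \<eta> = k - n \<longrightarrow>
      (\<eta> \<le> n \<longrightarrow>
         real (E2 n k) =
           fact (n + \<eta>) / (fact \<eta> * fact (n - \<eta>) * 2 ^ \<eta>) *
           hyp2F1 (- (real \<eta> / 2)) (- (real \<eta> / 2) + 1 / 2) (real n - real \<eta> + 1) (8 / 3)) \<and>
      (\<eta> \<ge> n \<longrightarrow>
         real (E2 n k) =
           fact (\<eta> + n) / (fact (2 * n - \<eta>) * fact (\<eta> - n) * 2 ^ n * 3 ^ (\<eta> - n)) *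
           hyp2F1 (- real n + real \<eta> / 2) (- real n + real \<eta> / 2 + 1 / 2)
             (real \<eta> - real n + 1) (8 / 3))) \<and>
   (\<forall>n :: nat. real (G2 n) =
      (\<Sum>\<eta> = 0..<n.
         fact (n + \<eta>) / (fact \<eta> * fact (n - \<eta>) * 2 ^ \<eta>) *
         hyp2F1 (- (real \<eta> / 2)) (- (real \<eta> / 2) + 1 / 2) (real n - real \<eta> + 1) (8 / 3)) +
      (\<Sum>\<eta> = n..2 * n.
         fact (n + \<eta>) / (fact (2 * n - \<eta>) * fact (\<eta> - n) * 2 ^ n * 3 ^ (\<eta> - n)) *
         hyp2F1 (- real n + real \<eta> / 2) (- real n + real \<eta> / 2 + 1 / 2)
           (real \<eta> - real n + 1) (8 / 3)))"
proof (intro conjI allI impI)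
  fix n k e :: nat
  assume k: "n \<le> k \<and> k \<le> 3 * n \<and> e = k - n"
  then have *: "k = n + e" "e \<le> 2 * n"
    by auto
  {
    assume "e \<le> n"
    then show "real (E2 n k) =
       fact (n + e) / (fact e * fact (n - e) * 2 ^ e) *
       hyp2F1 (- (real e / 2)) (- (real e / 2) + 1 / 2) (real n - real e + 1) (8 / 3)"
      unfolding * by (rule E2_hyp2F1_low)
  }
  {
    assume "n \<le> e"
    then show "real (E2 n k) =
       fact (e + n) / (fact (2 * n - e) * fact (e - n) * 2 ^ n * 3 ^ (e - n)) *
       hyp2F1 (- real n + real e / 2) (- real n + real e / 2 + 1 / 2)
         (real e - real n + 1) (8 / 3)"
      unfolding *(1) add.commute[of e n] using *(2) by (rule E2_hyp2F1_high)
  }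
qed (simp add: G2_eq_sum_E2_split E2_hyp2F1_low E2_hyp2F1_high)

end
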